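(* Let $A\in\mathbb{R}^{n\times n}$ satisfy $A^\top=-A$, let $T>0$, let $b\in\mathbb{R}^n$ be a unit vector, and assume that $$\lambda_{\min}(G_T(A,b))\geq(1-\varepsilon)\frac Tn$$ for some $\varepsilon\in[0,1)$. Let $P_0$ be the orthogonal projector onto $\ker A$. Then $(A,b)$ is controllable, and there exists $\sigma\in\{-1,1\}$ such that $$\Vert e^{TA}-(P_0+\sigma(\mathrm{Id}-P_0))\Vert\leq\sqrt{\frac{n}{1-\varepsilon}}\,\Vert A\Vert\,T\,\varepsilon.$$ If $\dim\ker A=1$ and the right-hand side of this inequality is smaller than $\sqrt2$, then necessarily $\sigma=1$.
   Context: $G_T(A,b)=\int_0^Te^{tA}bb^\top e^{tA^\top}\,dt$ is the controllability Gramian, and $\lambda_{\min}$ denotes the smallest eigenvalue of a symmetric matrix. Matrix norms are operator norms for the Euclidean norm. $\mathrm{Id}$ is the $n\times n$ identity matrix. $(A,b)$ is controllable if $\operatorname{span}(b,Ab,\ldots,A^{n-1}b)=\mathbb{R}^n$.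
   Formalization: That every σ satisfying the inequality must be 1 is stated for n ≥ 2 only: for n = 1, A = 0 and Id − P₀ = 0, so both signs satisfy it; for every n, including n = 1, a σ satisfying the inequality exists that equals 1 when dim ker A = 1 and the right-hand side is below √2. *)

theory Defs
  imports "HOL-Analysis.Analysis"
begin

(* On real^'n^'n the class operations * and ^ act entrywise and exp is not available, so matrix
   powers and the exponential series are built from the matrix product **. *)

primrec mat_pow :: "real^'n^'n \<Rightarrow> nat \<Rightarrow> real^'n^'n" where
  "mat_pow A 0 = mat 1"
| "mat_pow A (Suc k) = A ** mat_pow A k"

definition mat_exp :: "real^'n^'n \<Rightarrow> real^'n^'n" where
  "mat_exp A = (\<Sum>k. (1 / fact k) *\<^sub>R mat_pow A k)"

definition op_norm :: "real^'n^'n \<Rightarrow> real" where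
  "op_norm A = onorm (\<lambda>x. A *v x)"

definition gramian :: "real \<Rightarrow> real^'n^'n \<Rightarrow> real^'n \<Rightarrow> real^'n^'n" where
  "gramian T A b =
     integral {0..T} (\<lambda>t. mat_exp (t *\<^sub>R A) ** ((columnvector b :: real^1^'n) ** rowvector b)
                         ** mat_exp (t *\<^sub>R transpose A))"

definition eigenvalue :: "real^'n^'n \<Rightarrow> real \<Rightarrow> bool" where
  "eigenvalue M l \<longleftrightarrow> (\<exists>v. v \<noteq> 0 \<and> M *v v = l *\<^sub>R v)"

(* Meaningful for symmetric M, which has a smallest real eigenvalue. *)
definition lambda_min :: "real^'n^'n \<Rightarrow> real" where
  "lambda_min M = (LEAST l. eigenvalue M l)"

definition controllable :: "real^'n^'n \<Rightarrow> real^'n \<Rightarrow> bool" where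
  "controllable A b \<longleftrightarrow> span ((\<lambda>k. mat_pow A k *v b) ` {..<CARD('n)}) = UNIV"

definition mat_kernel :: "real^'n^'n \<Rightarrow> (real^'n) set" where
  "mat_kernel A = {x. A *v x = 0}"

definition orthogonal_projector_onto :: "real^'n^'n \<Rightarrow> (real^'n) set \<Rightarrow> bool" where
  "orthogonal_projector_onto P S \<longleftrightarrow>
     P ** P = P \<and> transpose P = P \<and> range (\<lambda>x. P *v x) = S"

end

theory Submission
  imports Defs
begin

text \<open>
  Write \<open>f t = e\<^sup>t\<^sup>A b\<close>, \<open>d = f T - b\<close> and \<open>s = f T + b\<close>. Since \<open>A\<close> is skew, integrating the derivative
  of \<open>f f\<^sup>T\<close> gives \<open>A G - G A = f(T) f(T)\<^sup>T - b b\<^sup>T\<close>. As \<open>G\<close> has trace \<open>T\<close>, its spectrum lies in an interval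
  of length \<open>\<epsilon> T\<close>, and centring \<open>G\<close> there and testing the commutator on \<open>d\<close> and \<open>s\<close>, which are orthogonal,
  yields \<open>\<bar>d\<bar> \<bar>s\<bar> \<le> 2 \<parallel>A\<parallel> T \<epsilon>\<close>. One of \<open>d\<close>, \<open>s\<close> has length at least \<open>sqrt 2\<close>; this determines \<open>\<sigma>\<close> and
  gives \<open>\<bar>V b\<bar> \<le> sqrt 2 \<parallel>A\<parallel> T \<epsilon>\<close> for \<open>V = e\<^sup>T\<^sup>A - (P\<^sub>0 + \<sigma> (Id - P\<^sub>0))\<close>. Finally \<open>V\<close> commutes with \<open>A\<close> and
  vanishes on \<open>ker A\<close>, so the top eigenspace of \<open>V\<^sup>T V\<close> contains a plane rotated by the flow; the lower bound on
  \<open>G\<close> makes the squared length of the component of \<open>b\<close> in it at least \<open>2 (1 - \<epsilon>) / n\<close>. The factor 2, available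
  because the plane is two-dimensional, cancels the loss of \<open>sqrt 2\<close> above.
  A unit vector \<open>x\<close> of \<open>ker A\<close> satisfies \<open>\<bar>s\<bar> \<ge> 2 \<bar>x \<bullet> b\<bar> \<ge> 2 sqrt ((1 - \<epsilon>) / n)\<close>, so \<open>\<sigma> = -1\<close> makes the bound
  at least \<open>sqrt 2\<close>.
\<close>

subsection \<open>Self-adjoint operators\<close>

text \<open>The first-order condition at a maximum: with no constant term, a nonzero linear
  coefficient would make the polynomial change sign at \<open>t = 0\<close>.\<close>

lemma psd_quadratic_zero:
  fixes a c :: real
  assumes "\<And>t. 0 \<le> 2 * t * a + t\<^sup>2 * c" and "0 \<le> c"
  shows "a = 0"
proof (rule ccontr)
  assume "a \<noteq> 0"
  \<comment> \<open>The test point is the minimiser \<open>- a / c\<close> with \<open>c + 1\<close>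
    in the denominator, which also covers \<open>c = 0\<close>.\<close>
  have "2 * (- a / (c + 1)) * a + (- a / (c + 1))\<^sup>2 * c = - (a\<^sup>2 * (c + 2)) / (c + 1)\<^sup>2"
    using \<open>0 \<le> c\<close> by (simp add: divide_simps) (simp add: algebra_simps power2_eq_square)
  moreover have "a\<^sup>2 * (c + 2) / (c + 1)\<^sup>2 > 0"
    using \<open>0 \<le> c\<close> \<open>a \<noteq> 0\<close> by (intro divide_pos_pos mult_pos_pos) auto
  ultimately show False
    using assms(1)[of "- a / (c + 1)"] by simp
qed

text \<open>The Rayleigh quotient attains its maximum on the compact unit sphere of
  \<open>S\<close>; perturbing the maximiser \<open>v\<close> along its residual \<open>w\<close>
  shows that \<open>w\<close> vanishes. A general invariant \<open>S\<close> is allowed so that the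
  result can be applied inside an eigenspace.\<close>

lemma selfadjoint_max_eigenvector:
  fixes f :: "'a::euclidean_space \<Rightarrow> 'a"
  assumes lin: "linear f" and S: "subspace S" "S \<noteq> {0}"
    and inv: "\<And>x. x \<in> S \<Longrightarrow> f x \<in> S"
    and sym: "\<And>x y. x \<bullet> f y = f x \<bullet> y"
  obtains v l where "v \<in> S" "norm v = 1" "f v = l *\<^sub>R v" "\<And>x. x \<in> S \<Longrightarrow> x \<bullet> f x \<le> l * (norm x)\<^sup>2"
proof -
  interpret f: bounded_linear f using lin linear_conv_bounded_linear by blast
  let ?K = "S \<inter> sphere 0 1"
  have "compact ?K"
    using closed_subspace[OF S(1)] by (intro closed_Int_compact) auto
  moreover obtain u where u: "u \<in> S" "u \<noteq> 0"
    using S subspace_0 by blast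
  then have "(1 / norm u) *\<^sub>R u \<in> ?K"
    using S by (auto intro: subspace_scale)
  then have "?K \<noteq> {}" by blast
  moreover have "continuous_on ?K (\<lambda>x. x \<bullet> f x)"
    by (intro continuous_intros f.continuous_on)
  ultimately obtain v where v: "v \<in> ?K" "\<And>x. x \<in> ?K \<Longrightarrow> x \<bullet> f x \<le> v \<bullet> f v"
    using continuous_attains_sup[of ?K "\<lambda>x. x \<bullet> f x"] by blast
  define l where "l = v \<bullet> f v"
  have le: "x \<bullet> f x \<le> l * (norm x)\<^sup>2" if "x \<in> S" for x
  proof (cases "x = 0")
    case False
    then have "(1 / norm x) *\<^sub>R x \<in> ?K"
      using S that by (auto intro: subspace_scale)
    from v(2)[OF this] show ?thesis
      using False by (simp add: f.scaleR l_def power2_eq_square field_simps)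
  qed (simp add: f.zero)
  define w where "w = l *\<^sub>R v - f v"
  have vS: "v \<in> S" and nv: "v \<bullet> v = 1" using v(1) by (auto simp: norm_eq_1)
  have wS: "w \<in> S"
    unfolding w_def using S vS inv by (intro subspace_diff subspace_scale) auto
  define c where "c = l * (w \<bullet> w) - w \<bullet> f w"
  have "c \<ge> 0" using le[OF wS] by (simp add: c_def power2_norm_eq_inner)
  have "0 \<le> 2 * t * (w \<bullet> w) + t\<^sup>2 * c" for t
  proof -
    have "v + t *\<^sub>R w \<in> S" using S vS wS by (intro subspace_add subspace_scale) auto
    from le[OF this]
    have "0 \<le> l * ((v + t *\<^sub>R w) \<bullet> (v + t *\<^sub>R w)) - (v + t *\<^sub>R w) \<bullet> f (v + t *\<^sub>R w)"
      by (simp add: power2_norm_eq_inner)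
    also have "\<dots> = (l * (v \<bullet> v) - v \<bullet> f v) + 2 * t * (w \<bullet> (l *\<^sub>R v - f v)) + t\<^sup>2 * c"
      using sym[of v w]
      by (simp add: f.add f.scaleR c_def algebra_simps inner_commute power2_eq_square)
    also have "\<dots> = 2 * t * (w \<bullet> w) + t\<^sup>2 * c"
      by (simp add: nv l_def[symmetric] w_def[symmetric])
    finally show ?thesis .
  qed
  from psd_quadratic_zero[OF this \<open>c \<ge> 0\<close>] have "f v = l *\<^sub>R v"
    by (simp add: w_def)
  with le vS v(1) show ?thesis by (intro that[of v l]) auto
qed

text \<open>Polarization and the parallelogram law turn the bound on the quadratic form into one on
  \<open>y \<bullet> f x\<close>, where \<open>y\<close> is the multiple of \<open>f x\<close> that
  is as long as \<open>x\<close>.\<close>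

lemma selfadjoint_norm_le:
  fixes f :: "'a::euclidean_space \<Rightarrow> 'a"
  assumes lin: "linear f" and sym: "\<And>x y. x \<bullet> f y = f x \<bullet> y"
    and b: "\<And>x. \<bar>x \<bullet> f x\<bar> \<le> c * (norm x)\<^sup>2"
  shows "norm (f x) \<le> c * norm x"
proof (cases "f x = 0")
  case True
  have "0 \<le> c * norm x"
  proof (cases "x = 0")
    case False
    have "0 \<le> c * (norm x)\<^sup>2" using b[of x] by (rule order_trans[OF abs_ge_zero])
    then have "0 \<le> c" using False by (simp add: zero_le_mult_iff)
    then show ?thesis by simp
  qed simp
  with True show ?thesis by simp
next
  case False
  interpret f: linear f by fact
  have x: "x \<noteq> 0" using False f.zero by auto
  define y where "y = (norm x / norm (f x)) *\<^sub>R f x"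
  have ny: "norm y = norm x" using False by (simp add: y_def)
  have "4 * (y \<bullet> f x) = (x + y) \<bullet> f (x + y) - (x - y) \<bullet> f (x - y)"
    using sym[of x y] by (simp add: f.add f.diff algebra_simps inner_commute)
  also have "\<dots> \<le> c * (norm (x + y))\<^sup>2 + c * (norm (x - y))\<^sup>2"
    using b[of "x + y"] b[of "x - y"] by linarith
  also have "\<dots> = c * (2 * (norm x)\<^sup>2 + 2 * (norm y)\<^sup>2)"
    by (simp add: power2_norm_eq_inner algebra_simps inner_commute)
  finally have "y \<bullet> f x \<le> c * (norm x)\<^sup>2" by (simp add: ny)
  moreover have "y \<bullet> f x = norm x * norm (f x)"
    using False by (simp add: y_def power2_norm_eq_inner[symmetric] power2_eq_square)
  ultimately have "norm x * norm (f x) \<le> norm x * (c * norm x)"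
    by (simp add: power2_eq_square mult_ac)
  then show ?thesis using x by simp
qed

subsection \<open>The matrix exponential\<close>

lemma matrix_mul_scaleR:
  fixes A B :: "real^'n^'n"
  shows "(c *\<^sub>R A) ** B = c *\<^sub>R (A ** B)" "A ** (c *\<^sub>R B) = c *\<^sub>R (A ** B)"
  by (simp_all add: vec_eq_iff matrix_matrix_mult_def sum_distrib_left mult_ac)

lemma linear_matrix_maps:
  fixes A :: "real^'n^'n"
  shows "linear (\<lambda>X :: real^'n^'n. A ** X)" "linear (\<lambda>X :: real^'n^'n. X ** A)"
    "linear (transpose :: real^'n^'n \<Rightarrow> _)" "linear (\<lambda>X :: real^'n^'n. x \<bullet> (X *v y))"
proof -
  show "linear (\<lambda>X :: real^'n^'n. A ** X)"
    by (rule linearI) (simp_all add: matrix_add_ldistrib matrix_mul_scaleR)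
  show "linear (\<lambda>X :: real^'n^'n. X ** A)"
    by (rule linearI) (simp_all add: vec_eq_iff matrix_matrix_mult_def sum.distrib sum_distrib_left algebra_simps)
  show "linear (transpose :: real^'n^'n \<Rightarrow> _)"
    by (rule linearI) (simp_all add: vec_eq_iff transpose_def)
  show "linear (\<lambda>X :: real^'n^'n. x \<bullet> (X *v y))"
    by (rule linearI) (simp_all add: matrix_vector_mult_add_rdistrib inner_add_right scaleR_matrix_vector_assoc[symmetric])
qed

text \<open>Left multiplication by \<open>A\<close> is bounded by some \<open>C\<close>, so up to a
  constant factor the terms are dominated by the exponential series of \<open>C\<close>.\<close>

lemma summable_mat_exp: "summable (\<lambda>k. (1 / fact k) *\<^sub>R mat_pow (A :: real^'n^'n) k)"
proof -
  have "bounded_linear (\<lambda>X :: real^'n^'n. A ** X)"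
    by (rule linear_conv_bounded_linear[THEN iffD1, OF linear_matrix_maps(1)])
  from bounded_linear.pos_bounded[OF this]
  obtain C where C: "C > 0" "\<And>X :: real^'n^'n. norm (A ** X) \<le> norm X * C" by blast
  have "norm (mat_pow A k) \<le> norm (mat 1 :: real^'n^'n) * C ^ k" for k
  proof (induction k)
    case (Suc k)
    have "norm (mat_pow A (Suc k)) \<le> norm (mat_pow A k) * C" by (simp add: C)
    also have "\<dots> \<le> (norm (mat 1 :: real^'n^'n) * C ^ k) * C" using Suc C by simp
    finally show ?case by (simp add: mult_ac)
  qed simp
  then have "norm ((1 / fact k) *\<^sub>R mat_pow A k) \<le> norm (mat 1 :: real^'n^'n) * (inverse (fact k) * C ^ k)" for k
    by (simp add: field_simps)
  then show ?thesis
    by (intro summable_comparison_test[OF _ summable_mult[OF summable_exp[of C]]]) auto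
qed

lemma mat_pow_scaleR: "mat_pow (t *\<^sub>R A) k = t ^ k *\<^sub>R mat_pow A k"
  by (induction k) (simp_all add: matrix_mul_scaleR)

lemma mat_pow_commute: "mat_pow A k ** A = A ** mat_pow A k"
  by (induction k) (simp_all add: matrix_mul_assoc[symmetric])

lemma mat_pow_transpose: "mat_pow (transpose A) k = transpose (mat_pow A k)"
  by (induction k) (simp_all add: matrix_transpose_mul transpose_mat mat_pow_commute[symmetric])

lemma mat_exp_sums: "(\<lambda>k. (t ^ k / fact k) *\<^sub>R mat_pow A k) sums mat_exp (t *\<^sub>R A)"
  using summable_sums[OF summable_mat_exp[of "t *\<^sub>R A"]]
  by (simp add: mat_exp_def mat_pow_scaleR)

lemma linear_mat_exp_sums:
  fixes h :: "real^'n^'n \<Rightarrow> 'b::real_normed_vector"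
  assumes "linear h"
  shows "(\<lambda>k. (t ^ k / fact k) *\<^sub>R h (mat_pow A k)) sums h (mat_exp (t *\<^sub>R A))"
proof -
  interpret bounded_linear h using assms linear_conv_bounded_linear by blast
  show ?thesis using sums[OF mat_exp_sums[of t A]] by (simp add: scaleR)
qed

lemma linear_mat_exp_eqI:
  fixes h h' :: "real^'n^'n \<Rightarrow> 'b::real_normed_vector"
  assumes "linear h" "linear h'" "\<And>k. h (mat_pow A k) = h' (mat_pow B k)"
  shows "h (mat_exp (t *\<^sub>R A)) = h' (mat_exp (t *\<^sub>R B))"
  using linear_mat_exp_sums[OF assms(1), of t A] linear_mat_exp_sums[OF assms(2), of t B]
  by (simp add: assms(3) sums_unique2)

lemma mat_exp_commute: "mat_exp (t *\<^sub>R A) ** A = A ** mat_exp (t *\<^sub>R A)"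
  by (rule linear_mat_exp_eqI) (simp_all add: linear_matrix_maps mat_pow_commute)

lemma mat_exp_transpose: "mat_exp (t *\<^sub>R transpose A) = transpose (mat_exp (t *\<^sub>R A))"
  by (rule linear_mat_exp_eqI[where h = "\<lambda>X. X"]) (simp_all add: linear_matrix_maps mat_pow_transpose linear_id[unfolded id_def])

lemma mat_exp_0: "mat_exp (0 :: real^'n^'n) = mat 1"
proof -
  have "(\<lambda>k. (0 ^ k / fact k) *\<^sub>R mat_pow (0 :: real^'n^'n) k) = (\<lambda>k. if k = 0 then mat_pow 0 k else 0)"
    by auto
  also have "\<dots> sums mat_pow (0 :: real^'n^'n) 0"
    by (rule sums_single)
  finally have "(\<lambda>k. (0 ^ k / fact k) *\<^sub>R mat_pow (0 :: real^'n^'n) k) sums mat 1" by simp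
  with mat_exp_sums[of 0 "0 :: real^'n^'n"] show ?thesis by (simp add: sums_unique2)
qed

text \<open>Matrix coefficients of the flow are everywhere convergent real power series in
  \<open>t\<close>, so termwise differentiation applies.\<close>

lemma mat_exp_inner_has_derivative:
  fixes A :: "real^'n^'n"
  shows "((\<lambda>t. x \<bullet> (mat_exp (t *\<^sub>R A) *v y)) has_real_derivative x \<bullet> (A *v (mat_exp (t *\<^sub>R A) *v y))) (at t)"
proof -
  define c where "c k = x \<bullet> (mat_pow A k *v y) / fact k" for k
  have s: "(\<lambda>k. c k * t ^ k) sums (x \<bullet> (mat_exp (t *\<^sub>R A) *v y))" for t
    using linear_mat_exp_sums[OF linear_matrix_maps(4), where t = t and A = A and x1 = x and y1 = y] by (simp add: c_def mult_ac)
  have "((\<lambda>t. \<Sum>k. c k * t ^ k) has_real_derivative (\<Sum>k. diffs c k * t ^ k)) (at t)"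
    by (rule termdiffs_strong_converges_everywhere) (use s sums_summable in blast)
  moreover have "(\<lambda>t. \<Sum>k. c k * t ^ k) = (\<lambda>t. x \<bullet> (mat_exp (t *\<^sub>R A) *v y))"
    using s by (auto simp: sums_iff)
  moreover have "linear (\<lambda>X. x \<bullet> ((A ** X) *v y))"
    using linear_compose[OF linear_matrix_maps(1) linear_matrix_maps(4)[of x y], of A] by (simp add: o_def)
  from linear_mat_exp_sums[OF this, of t A]
  have "(\<lambda>k. diffs c k * t ^ k) sums (x \<bullet> (A *v (mat_exp (t *\<^sub>R A) *v y)))"
    by (simp add: c_def diffs_def matrix_vector_mul_assoc mult_ac del: of_nat_Suc)
  then have "(\<Sum>k. diffs c k * t ^ k) = x \<bullet> (A *v (mat_exp (t *\<^sub>R A) *v y))"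
    by (simp add: sums_iff)
  ultimately show ?thesis by simp
qed

lemma uminus_matrix_vector: "(- A) *v x = - (A *v (x :: real^'n))" for A :: "real^'n^'m"
  by (simp add: vec_eq_iff matrix_vector_mult_def sum_negf)

lemma inner_matrix_vector: "x \<bullet> (A *v y) = (transpose A *v x) \<bullet> y" for A :: "real^'n^'n"
  by (simp add: dot_lmul_matrix transpose_matrix_vector)

text \<open>The maximum principle for \<open>- M\<close> yields an eigenvalue of \<open>M\<close>
  that bounds the quadratic form from below; this shows that the \<open>LEAST\<close> in
  \<open>lambda_min\<close> is attained.\<close>

lemma lambda_min_le_rayleigh:
  fixes M :: "real^'n^'n"
  assumes "transpose M = M"
  shows "lambda_min M * (norm x)\<^sup>2 \<le> x \<bullet> (M *v x)"
proof -
  have "linear (\<lambda>x. - (M *v x))"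
    by (rule linearI) (simp_all add: matrix_vector_right_distrib matrix_vector_mult_scaleR)
  moreover have "(UNIV :: (real^'n) set) \<noteq> {0}"
    using UNIV_I[of "axis undefined 1 :: real^'n"] by (auto simp: axis_eq_0_iff)
  ultimately obtain v l where v: "norm v = 1" "- (M *v v) = l *\<^sub>R v"
    and le: "\<And>x. x \<bullet> - (M *v x) \<le> l * (norm x)\<^sup>2"
    using selfadjoint_max_eigenvector[of "\<lambda>x. - (M *v x)" UNIV] assms
    by (auto simp: inner_matrix_vector)
  have "lambda_min M = - l"
    unfolding lambda_min_def
  proof (rule Least_equality)
    show "eigenvalue M (- l)"
      unfolding eigenvalue_def proof (intro exI[of _ v] conjI)
      show "M *v v = - l *\<^sub>R v" using v(2) by (metis minus_minus scaleR_minus_left)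
    qed (use v(1) in auto)
    show "- l \<le> m" if "eigenvalue M m" for m
    proof -
      from that obtain u where u: "u \<noteq> 0" "M *v u = m *\<^sub>R u" by (auto simp: eigenvalue_def)
      from le[of u] u(2) have "- m * (norm u)\<^sup>2 \<le> l * (norm u)\<^sup>2"
        by (simp add: power2_norm_eq_inner)
      with u(1) have "- m \<le> l" by (metis mult_right_le_imp_le zero_less_norm_iff zero_less_power)
      then show ?thesis by simp
    qed
  qed
  with le[of x] show ?thesis by simp
qed

lemma op_norm_bound: "norm (A *v x) \<le> op_norm A * norm x"
  unfolding op_norm_def by (rule onorm) (rule matrix_vector_mul_bounded_linear)

lemma flow_has_vector_derivative:
  fixes A :: "real^'n^'n"
  shows "((\<lambda>t. mat_exp (t *\<^sub>R A) *v b) has_vector_derivative A *v (mat_exp (t *\<^sub>R A) *v b)) (at t within S)"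
proof -
  have "((\<lambda>t. (mat_exp (t *\<^sub>R A) *v b) \<bullet> i) has_derivative (\<lambda>h. (h *\<^sub>R (A *v (mat_exp (t *\<^sub>R A) *v b))) \<bullet> i))
      (at t within S)" for i
    using has_field_derivative_at_within[OF mat_exp_inner_has_derivative[of i A b t], of S]
    by (simp add: has_field_derivative_def inner_commute mult_commute_abs)
  then show ?thesis
    by (simp add: has_vector_derivative_def has_derivative_componentwise_within[of "\<lambda>t. mat_exp (t *\<^sub>R A) *v b"])
qed

lemma flow_inner_has_derivative:
  fixes A :: "real^'n^'n"
  shows "((\<lambda>t. (x \<bullet> (mat_exp (t *\<^sub>R A) *v b)) * (y \<bullet> (mat_exp (t *\<^sub>R A) *v b))) has_real_derivative
     (x \<bullet> (A *v (mat_exp (t *\<^sub>R A) *v b))) * (y \<bullet> (mat_exp (t *\<^sub>R A) *v b)) +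
     (x \<bullet> (mat_exp (t *\<^sub>R A) *v b)) * (y \<bullet> (A *v (mat_exp (t *\<^sub>R A) *v b)))) (at t)"
  by (rule DERIV_cong[OF DERIV_mult[OF mat_exp_inner_has_derivative mat_exp_inner_has_derivative]]) simp

subsection \<open>The controllability Gramian\<close>

lemma columnvector_rowvector_inner:
  "x \<bullet> (((columnvector u :: real^1^'n) ** rowvector u) *v y) = (x \<bullet> u) * (y \<bullet> (u :: real^'n))"
proof -
  have "((columnvector u :: real^1^'n) ** rowvector u) *v y = (y \<bullet> u) *\<^sub>R u"
    by (simp add: vec_eq_iff matrix_vector_mult_def matrix_matrix_mult_def columnvector_def rowvector_def
        inner_vec_def sum_distrib_left mult_ac)
  then show ?thesis by simp
qed

lemma gramian_integrand:
  fixes A :: "real^'n^'n"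
  shows "mat_exp (t *\<^sub>R A) ** ((columnvector b :: real^1^'n) ** rowvector b) ** mat_exp (t *\<^sub>R transpose A)
     = (columnvector (mat_exp (t *\<^sub>R A) *v b) :: real^1^'n) ** rowvector (mat_exp (t *\<^sub>R A) *v b)"
proof -
  have "E ** (columnvector b :: real^1^'n) = columnvector (E *v b)" for E :: "real^'n^'n"
    by (simp add: vec_eq_iff matrix_vector_mult_def matrix_matrix_mult_def columnvector_def)
  moreover have "(rowvector b :: real^'n^1) ** transpose E = rowvector (E *v b)" for E :: "real^'n^'n"
    by (simp add: vec_eq_iff matrix_vector_mult_def matrix_matrix_mult_def rowvector_def transpose_def mult_ac)
  ultimately show ?thesis by (simp add: mat_exp_transpose matrix_mul_assoc) (simp add: matrix_mul_assoc[symmetric])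
qed

text \<open>From here on the Gramian is handled only through its bilinear form. Continuity makes the
  integrand integrable, so \<open>integral\<close> is not a default value.\<close>

lemma gramian_has_integral:
  fixes A :: "real^'n^'n"
  shows "((\<lambda>t. (x \<bullet> (mat_exp (t *\<^sub>R A) *v b)) * (y \<bullet> (mat_exp (t *\<^sub>R A) *v b))) has_integral
    x \<bullet> (gramian T A b *v y)) {0..T}"
proof -
  define M where "M t = (columnvector (mat_exp (t *\<^sub>R A) *v b) :: real^1^'n) ** rowvector (mat_exp (t *\<^sub>R A) *v b)" for t
  have flow: "continuous_on {0..T} (\<lambda>t. mat_exp (t *\<^sub>R A) *v b)"
    using flow_has_vector_derivative by (rule continuous_on_vector_derivative)
  have "M = (\<lambda>t. \<chi> i j. (mat_exp (t *\<^sub>R A) *v b) $ i * (mat_exp (t *\<^sub>R A) *v b) $ j)"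
    by (simp add: M_def fun_eq_iff vec_eq_iff matrix_matrix_mult_def columnvector_def rowvector_def)
  then have "continuous_on {0..T} M"
    using flow by (auto intro!: continuous_intros)
  then have "(M has_integral gramian T A b) {0..T}"
    unfolding gramian_def gramian_integrand M_def[symmetric]
    by (intro integrable_integral integrable_continuous_real)
  moreover have "bounded_linear (\<lambda>X :: real^'n^'n. x \<bullet> (X *v y))"
    by (rule linear_conv_bounded_linear[THEN iffD1, OF linear_matrix_maps(4)])
  ultimately have "((\<lambda>X. x \<bullet> (X *v y)) \<circ> M has_integral x \<bullet> (gramian T A b *v y)) {0..T}"
    by (rule has_integral_linear)
  then show ?thesis
    by (simp add: o_def M_def columnvector_rowvector_inner)
qed

lemma gramian_transpose: "transpose (gramian T A b) = gramian T A b"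
proof -
  have sym: "x \<bullet> (gramian T A b *v y) = y \<bullet> (gramian T A b *v x)" for x y
    using gramian_has_integral[of x A b y T] gramian_has_integral[of y A b x T]
    by (intro has_integral_unique) (simp_all add: mult.commute)
  then have "x \<bullet> (transpose (gramian T A b) *v y) = x \<bullet> (gramian T A b *v y)" for x y
    using sym[of y x] inner_matrix_vector[of x "transpose (gramian T A b)" y] by (simp add: inner_commute)
  then show ?thesis
    unfolding matrix_eq using vector_eq_ldot by blast
qed

section \<open>Flows generated by skew-symmetric matrices\<close>

context
  fixes A :: "real^'n^'n"
  assumes skew: "transpose A = - A"
begin

lemma inner_skew: "x \<bullet> (A *v y) = - ((A *v x) \<bullet> y)"
  by (simp add: inner_matrix_vector skew uminus_matrix_vector)

text \<open>Skewness cancels the two terms in the derivative of the inner product.\<close>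

lemma flow_inner: "(mat_exp (t *\<^sub>R A) *v x) \<bullet> (mat_exp (t *\<^sub>R A) *v y) = x \<bullet> y"
proof -
  let ?g = "\<lambda>t. (mat_exp (t *\<^sub>R A) *v x) \<bullet> (mat_exp (t *\<^sub>R A) *v y)"
  have "(?g has_real_derivative 0) (at t)" for t
    using bounded_bilinear.has_vector_derivative[OF bounded_bilinear_inner
        flow_has_vector_derivative[of A x t UNIV] flow_has_vector_derivative[of A y t UNIV]]
    by (simp add: has_real_derivative_iff_has_vector_derivative inner_skew)
  with DERIV_isconst_all[of ?g t 0] show ?thesis
    by (simp add: mat_exp_0)
qed

lemma flow_norm: "norm (mat_exp (t *\<^sub>R A) *v x) = norm x"
  by (simp add: norm_eq_sqrt_inner flow_inner)

lemma inner_flow_kernel: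
  assumes "A *v x = 0"
  shows "x \<bullet> (mat_exp (t *\<^sub>R A) *v y) = x \<bullet> y"
proof -
  have "((\<lambda>t. x \<bullet> (mat_exp (t *\<^sub>R A) *v y)) has_real_derivative 0) (at t)" for t
    using mat_exp_inner_has_derivative[of x A y t] assms by (simp add: inner_skew)
  with DERIV_isconst_all[of "\<lambda>t. x \<bullet> (mat_exp (t *\<^sub>R A) *v y)" t 0] show ?thesis
    by (simp add: mat_exp_0)
qed

text \<open>The equality case of Cauchy-Schwarz: the flow preserves the length of \<open>x\<close>
  and, by \<open>inner_flow_kernel\<close>, the inner product with \<open>x\<close>.\<close>

lemma flow_kernel:
  assumes "A *v x = 0"
  shows "mat_exp (t *\<^sub>R A) *v x = x"
proof -
  have "(mat_exp (t *\<^sub>R A) *v x) \<bullet> x = x \<bullet> x"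
    using inner_flow_kernel[OF assms, of t x] by (simp add: inner_commute)
  then have "(mat_exp (t *\<^sub>R A) *v x - x) \<bullet> (mat_exp (t *\<^sub>R A) *v x - x) = 0"
    by (simp add: inner_diff flow_inner inner_commute)
  then show ?thesis by simp
qed

text \<open>The commutator identity in weak form: the product rule is integrated over
  \<open>{0..T}\<close>, and skewness moves \<open>A\<close> to the test vectors at the cost of a
  sign.\<close>

lemma gramian_commutator:
  assumes "0 \<le> T"
  shows "(A *v x) \<bullet> (gramian T A b *v y) + x \<bullet> (gramian T A b *v (A *v y)) =
    (x \<bullet> b) * (y \<bullet> b) - (x \<bullet> (mat_exp (T *\<^sub>R A) *v b)) * (y \<bullet> (mat_exp (T *\<^sub>R A) *v b))"
proof -
  let ?f = "\<lambda>t. mat_exp (t *\<^sub>R A) *v b"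
  have "((\<lambda>t. (x \<bullet> (A *v ?f t)) * (y \<bullet> ?f t) + (x \<bullet> ?f t) * (y \<bullet> (A *v ?f t))) has_integral
      (x \<bullet> ?f T) * (y \<bullet> ?f T) - (x \<bullet> ?f 0) * (y \<bullet> ?f 0)) {0..T}"
    using assms has_field_derivative_at_within[OF flow_inner_has_derivative]
    by (intro fundamental_theorem_of_calculus)
      (simp_all add: has_real_derivative_iff_has_vector_derivative[symmetric])
  from has_integral_neg[OF this]
  have "((\<lambda>t. ((A *v x) \<bullet> ?f t) * (y \<bullet> ?f t) + (x \<bullet> ?f t) * ((A *v y) \<bullet> ?f t)) has_integral
      (x \<bullet> b) * (y \<bullet> b) - (x \<bullet> ?f T) * (y \<bullet> ?f T)) {0..T}"
    by (simp add: inner_skew mat_exp_0 algebra_simps)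
  with has_integral_add[OF gramian_has_integral gramian_has_integral]
  show ?thesis by (rule has_integral_unique)
qed

text \<open>The flow is isometric, so the Gramian has trace \<open>T * (norm b)\<^sup>2\<close>. In
  an orthonormal basis containing the direction of \<open>x\<close>, each of the other diagonal
  entries is at least \<open>c\<close>.\<close>

lemma gramian_le:
  assumes "0 \<le> T" and c: "\<And>x. c * (norm x)\<^sup>2 \<le> x \<bullet> (gramian T A b *v x)"
  shows "x \<bullet> (gramian T A b *v x) \<le> (T * (norm b)\<^sup>2 - (real CARD('n) - 1) * c) * (norm x)\<^sup>2"
proof -
  let ?G = "gramian T A b"
  have unit: "u \<bullet> (?G *v u) \<le> T * (norm b)\<^sup>2 - (real CARD('n) - 1) * c" if u: "norm u = 1" for u
  proof -
    \<comment> \<open>Any index \<open>k\<close> will do: \<open>Q\<close> carries the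
      \<open>k\<close>-th axis vector to \<open>u\<close>, and its columns \<open>e i\<close> form
      the basis.\<close>
    fix k :: 'n
    obtain Q where Q: "orthogonal_matrix Q" "Q *v axis k 1 = u"
      using orthogonal_matrix_exists_basis[OF u] .
    then have Qt: "norm (transpose Q *v x) = norm x" for x
      using inner_matrix_vector[of x Q "transpose Q *v x"]
      by (simp add: norm_eq_sqrt_inner matrix_vector_mul_assoc orthogonal_matrix_def del: transpose_matrix_vector)
    define e where "e i = Q *v axis i 1" for i
    have "e i \<bullet> x = (transpose Q *v x) $ i" for i x
      using inner_matrix_vector[of "axis i 1" "transpose Q" x]
      by (simp add: e_def inner_axis' del: transpose_matrix_vector)
    then have parseval: "(\<Sum>i\<in>UNIV. (e i \<bullet> x)\<^sup>2) = (norm x)\<^sup>2" for x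
      using power2_norm_eq_inner[of "transpose Q *v x"]
      by (simp add: Qt inner_vec_def power2_eq_square del: transpose_matrix_vector)
    have ne: "norm (e i) = 1" for i
      using Qt[of "e i"] Q(1) by (simp add: e_def matrix_vector_mul_assoc orthogonal_matrix_def del: transpose_matrix_vector)
    have "((\<lambda>t. \<Sum>i\<in>UNIV. (e i \<bullet> (mat_exp (t *\<^sub>R A) *v b))\<^sup>2) has_integral (\<Sum>i\<in>UNIV. e i \<bullet> (?G *v e i))) {0..T}"
      unfolding power2_eq_square by (intro has_integral_sum gramian_has_integral) simp
    then have "((\<lambda>t. (norm b)\<^sup>2) has_integral (\<Sum>i\<in>UNIV. e i \<bullet> (?G *v e i))) {0..T}"
      by (simp add: parseval flow_norm)
    moreover have "((\<lambda>t. (norm b)\<^sup>2) has_integral T * (norm b)\<^sup>2) {0..T}"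
      using has_integral_const_real[of "(norm b)\<^sup>2" 0 T] \<open>0 \<le> T\<close> by simp
    ultimately have "(\<Sum>i\<in>UNIV. e i \<bullet> (?G *v e i)) = T * (norm b)\<^sup>2"
      by (rule has_integral_unique)
    moreover have "(\<Sum>i\<in>UNIV. e i \<bullet> (?G *v e i)) = u \<bullet> (?G *v u) + (\<Sum>i\<in>UNIV - {k}. e i \<bullet> (?G *v e i))"
      using Q(2) by (simp add: sum.remove[of _ k] e_def)
    moreover have "(\<Sum>i\<in>UNIV - {k}. c) \<le> (\<Sum>i\<in>UNIV - {k}. e i \<bullet> (?G *v e i))"
      using c ne by (intro sum_mono) (metis mult.right_neutral one_power2)
    moreover have "(\<Sum>i\<in>UNIV - {k}. c) = (real CARD('n) - 1) * c"
      by (simp add: card_Diff_singleton of_nat_diff Suc_leI)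
    ultimately show ?thesis by linarith
  qed
  show ?thesis
  proof (cases "x = 0")
    case False
    have "norm ((1 / norm x) *\<^sub>R x) = 1" using False by simp
    from unit[OF this] False show ?thesis
      by (simp add: matrix_vector_mult_scaleR field_simps power2_eq_square)
  qed simp
qed

lemma gramian_endpoint_bound:
  assumes "0 \<le> T" and c: "\<And>x. c * (norm x)\<^sup>2 \<le> x \<bullet> (gramian T A b *v x)"
  defines "b1 \<equiv> mat_exp (T *\<^sub>R A) *v b"
  shows "norm (b1 - b) * norm (b1 + b) \<le> 2 * op_norm A * (T * (norm b)\<^sup>2 - real CARD('n) * c)"
proof -
  let ?G = "gramian T A b"
  define w where "w = T * (norm b)\<^sup>2 - real CARD('n) * c"
  \<comment> \<open>The commutator with \<open>A\<close> is unchanged when the Gramian is centred at the midpoint of its spectral range.\<close>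
  define F where "F x = ?G *v x - (c + w / 2) *\<^sub>R x" for x
  have "linear F"
    by (rule linearI) (simp_all add: F_def matrix_vector_right_distrib matrix_vector_mult_scaleR algebra_simps)
  moreover have symF: "x \<bullet> F y = F x \<bullet> y" for x y
    by (simp add: F_def inner_diff inner_matrix_vector gramian_transpose)
  moreover have "\<bar>x \<bullet> F x\<bar> \<le> (w / 2) * (norm x)\<^sup>2" for x
  proof -
    have "x \<bullet> F x = x \<bullet> (?G *v x) - (c + w / 2) * (norm x)\<^sup>2"
      by (simp add: F_def inner_diff_right power2_norm_eq_inner)
    moreover have "x \<bullet> (?G *v x) \<le> (c + w) * (norm x)\<^sup>2"
      using gramian_le[OF assms(1) c, of x] by (simp add: w_def algebra_simps)
    ultimately show ?thesis
      using c[of x] by (simp add: abs_le_iff algebra_simps)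
  qed
  ultimately have F: "norm (F x) \<le> (w / 2) * norm x" for x
    by (rule selfadjoint_norm_le)
  define d s where "d = b1 - b" and "s = b1 + b"
  have "b1 \<bullet> b1 = b \<bullet> b" by (simp add: b1_def flow_inner)
  \<comment> \<open>With \<open>\<beta> = b \<bullet> b\<close> and
    \<open>\<gamma> = b \<bullet> b1\<close>, both sides equal
    \<open>4 * (\<beta>\<^sup>2 - \<gamma>\<^sup>2)\<close>.\<close>
  then have "norm d * norm s * (norm d * norm s) = 2 * ((d \<bullet> b1) * (s \<bullet> b1) - (d \<bullet> b) * (s \<bullet> b))"
    by (simp add: d_def s_def power2_norm_eq_inner[unfolded power2_eq_square] algebra_simps inner_commute
         flip: mult.assoc[of "norm _"])
  also have "\<dots> = - 2 * ((A *v d) \<bullet> F s + F d \<bullet> (A *v s))"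
    unfolding symF[of d "A *v s", symmetric]
    using gramian_commutator[OF assms(1), of d b s]
    by (simp add: F_def b1_def inner_diff_right inner_skew[of d s])
  also have "\<dots> \<le> 2 * (norm (A *v d) * norm (F s) + norm (F d) * norm (A *v s))"
    using abs_le_D2[OF Cauchy_Schwarz_ineq2[of "A *v d" "F s"]]
      abs_le_D2[OF Cauchy_Schwarz_ineq2[of "F d" "A *v s"]] by simp
  also have "\<dots> \<le> 2 * ((op_norm A * norm d) * (w / 2 * norm s) + (w / 2 * norm d) * (op_norm A * norm s))"
    by (intro mult_left_mono add_mono mult_mono' F op_norm_bound) simp_all
  also have "\<dots> = norm d * norm s * (2 * op_norm A * w)" by (simp add: algebra_simps)
  finally have le: "norm d * norm s * (norm d * norm s) \<le> norm d * norm s * (2 * op_norm A * w)" .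
  show ?thesis
  proof (cases "norm d * norm s = 0")
    case True
    have "0 \<le> op_norm A" unfolding op_norm_def by (intro onorm_pos_le matrix_vector_mul_bounded_linear)
    \<comment> \<open>Applied to a unit vector, the bound on \<open>F\<close> forces
      \<open>w\<close> to be nonnegative.\<close>
    moreover have "0 \<le> w / 2 * norm (axis undefined 1 :: real^'n)"
      using F norm_ge_zero order_trans by blast
    ultimately have "0 \<le> op_norm A * w" by simp
    with True show ?thesis by (simp only: w_def d_def s_def mult.assoc)
  next
    case False
    then have "norm d * norm s > 0" by simp
    with le have "norm d * norm s \<le> 2 * op_norm A * w" by (rule mult_left_le_imp_le)
    then show ?thesis by (simp add: w_def d_def s_def)
  qed
qed

text \<open>The flow conserves the component along a kernel vector, so the integrand of the Gramian
  form is constant.\<close>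

lemma kernel_component_bound:
  assumes "0 \<le> T" "A *v x = 0" "c * (norm x)\<^sup>2 \<le> x \<bullet> (gramian T A b *v x)"
  shows "c * (norm x)\<^sup>2 \<le> T * (x \<bullet> b)\<^sup>2"
proof -
  have "((\<lambda>t. (x \<bullet> b)\<^sup>2) has_integral x \<bullet> (gramian T A b *v x)) {0..T}"
    using gramian_has_integral[of x A b x T] by (simp add: inner_flow_kernel[OF assms(2)] power2_eq_square)
  moreover have "((\<lambda>t. (x \<bullet> b)\<^sup>2) has_integral T * (x \<bullet> b)\<^sup>2) {0..T}"
    using has_integral_const_real[of "(x \<bullet> b)\<^sup>2" 0 T] \<open>0 \<le> T\<close> by simp
  ultimately have "x \<bullet> (gramian T A b *v x) = T * (x \<bullet> b)\<^sup>2"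
    by (rule has_integral_unique)
  with assms(3) show ?thesis by simp
qed

end

text \<open>If the vectors fail to span, some nonzero \<open>y\<close> is orthogonal to every
  \<open>mat_pow A k *v b\<close>, hence to the whole orbit, and the Gramian form vanishes at
  \<open>y\<close>.\<close>

lemma controllable_if_gramian_pos:
  fixes A :: "real^'n^'n"
  assumes pos: "\<And>x. x \<noteq> 0 \<Longrightarrow> 0 < x \<bullet> (gramian T A b *v x)"
  shows "controllable A b"
proof (rule ccontr)
  define S where "S m = span ((\<lambda>k. mat_pow A k *v b) ` {..<m})" for m
  assume "\<not> controllable A b"
  then have S: "S (CARD('n)) \<noteq> UNIV" by (simp add: controllable_def S_def)
  \<comment> \<open>If each vector left the span of its predecessors, the dimension would grow at
    all \<open>CARD('n)\<close> steps and the span would be everything.\<close>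
  have "\<exists>m < CARD('n). mat_pow A m *v b \<in> S m"
  proof (rule ccontr)
    assume *: "\<not> ?thesis"
    have "dim (S m) = m" if "m \<le> CARD('n)" for m
      using that
    proof (induction m)
      case (Suc m)
      then have "mat_pow A m *v b \<notin> S m" using * by simp
      with Suc show ?case
        by (simp add: S_def lessThan_Suc dim_insert)
    qed (simp add: S_def)
    from this[of "CARD('n)"] have "S (CARD('n)) = UNIV"
      using dim_eq_full[of "S (CARD('n))"] by (simp add: S_def span_span del: dim_span)
    with S show False by simp
  qed
  then obtain m where m: "m < CARD('n)" "mat_pow A m *v b \<in> S m" by blast
  \<comment> \<open>The span is invariant: \<open>A\<close> maps each generator to the next, and the
    last one to \<open>mat_pow A m *v b\<close>, which lies in \<open>S m\<close> by the choice of
    \<open>m\<close>.\<close>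
  have "A *v y \<in> S m" if "y \<in> S m" for y
  proof -
    have "A *v (mat_pow A k *v b) \<in> S m" if "k < m" for k
    proof -
      have "mat_pow A (Suc k) *v b \<in> S m"
      proof (cases "Suc k = m")
        case False
        with that show ?thesis unfolding S_def by (intro span_base imageI) simp
      qed (use m(2) in simp)
      then show ?thesis by (simp add: matrix_vector_mul_assoc)
    qed
    then have "(*v) A ` ((\<lambda>k. mat_pow A k *v b) ` {..<m}) \<subseteq> S m" by auto
    then have "span ((*v) A ` ((\<lambda>k. mat_pow A k *v b) ` {..<m})) \<subseteq> S m"
      unfolding S_def by (rule span_minimal) (rule subspace_span)
    then show ?thesis
      using that by (auto simp: S_def linear_span_image)
  qed
  moreover have "b \<in> S m"
  proof (cases m)
    case 0
    with m(2) show ?thesis by simp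
  next
    case (Suc k)
    then have "mat_pow A 0 *v b \<in> S m" unfolding S_def by (intro span_base imageI) simp
    then show ?thesis by simp
  qed
  ultimately have "mat_pow A k *v b \<in> S m" for k
    by (induction k) (simp_all add: matrix_vector_mul_assoc[symmetric])
  moreover have "S m \<subseteq> S (CARD('n))"
    unfolding S_def using m(1) by (intro span_mono image_mono) auto
  moreover obtain y where y: "y \<noteq> 0" "\<And>x. x \<in> S (CARD('n)) \<Longrightarrow> y \<bullet> x = 0"
    using span_not_UNIV_orthogonal[of "(\<lambda>k. mat_pow A k *v b) ` {..<CARD('n)}"] S by (auto simp: S_def)
  ultimately have "y \<bullet> (mat_pow A k *v b) = 0" for k by blast
  with linear_mat_exp_sums[OF linear_matrix_maps(4)[of y b], of _ A]
  have "(\<lambda>k. 0) sums (y \<bullet> (mat_exp (t *\<^sub>R A) *v b))" for t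
    by simp
  from sums_unique2[OF this sums_zero] have "y \<bullet> (mat_exp (t *\<^sub>R A) *v b) = 0" for t .
  with gramian_has_integral[of y A b y T] have "((\<lambda>t. 0) has_integral y \<bullet> (gramian T A b *v y)) {0..T}"
    by simp
  then have "y \<bullet> (gramian T A b *v y) = 0"
    using has_integral_0 by (rule has_integral_unique)
  with pos[OF y(1)] show False by simp
qed

text \<open>The value of \<open>V\<close> at the single vector \<open>b\<close> controls its norm.
  The top eigenspace of \<open>V\<^sup>T V\<close> contains a plane rotated by the flow, and the
  Gramian bounds the component of \<open>b\<close> in that plane from below.\<close>

lemma commuting_norm_bound:
  fixes A V :: "real^'n^'n"
  assumes skew: "transpose A = - A"
    and "0 \<le> T" "0 \<le> c" and c: "\<And>x. c * (norm x)\<^sup>2 \<le> x \<bullet> (gramian T A b *v x)"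
    and comm: "\<And>x. V *v (A *v x) = A *v (V *v x)"
    and ker: "\<And>x. A *v x = 0 \<Longrightarrow> V *v x = 0"
  shows "2 * c * (norm (V *v x))\<^sup>2 \<le> T * (norm (V *v b))\<^sup>2 * (norm x)\<^sup>2"
proof -
  define N where "N x = transpose V *v (V *v x)" for x
  have linN: "linear N"
    by (rule linearI) (simp_all add: N_def matrix_vector_right_distrib matrix_vector_mult_scaleR del: transpose_matrix_vector)
  interpret N: linear N by fact
  have innerN: "x \<bullet> N y = (V *v x) \<bullet> (V *v y)" for x y
    using inner_matrix_vector[of x "transpose V" "V *v y"] by (simp add: N_def)
  then have symN: "x \<bullet> N y = N x \<bullet> y" for x y by (metis inner_commute)
  \<comment> \<open>In weak form, skewness moves \<open>A\<close> across the inner product and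
    \<open>comm\<close> passes it through \<open>V\<close>.\<close>
  have commN: "N (A *v x) = A *v N x" for x
  proof -
    have "y \<bullet> N (A *v x) = y \<bullet> (A *v N x)" for y
      by (simp only: innerN comm inner_skew[OF skew, of "V *v y"] inner_skew[OF skew, of y])
    then show ?thesis using vector_eq_ldot by blast
  qed
  have "(UNIV :: (real^'n) set) \<noteq> {0}"
    using UNIV_I[of "axis undefined 1 :: real^'n"] by (auto simp: axis_eq_0_iff)
  then obtain u l where u: "norm u = 1" "N u = l *\<^sub>R u" "\<And>x. x \<bullet> N x \<le> l * (norm x)\<^sup>2"
    using selfadjoint_max_eigenvector[of N UNIV] linN symN by auto
  have Vl: "(norm (V *v x))\<^sup>2 \<le> l * (norm x)\<^sup>2" for x
    using u(3)[of x] by (simp add: innerN power2_norm_eq_inner)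
  have "0 \<le> l" using order_trans[OF zero_le_power2 Vl[of u]] u(1) by simp
  show ?thesis
  proof (cases "l = 0")
    case True
    with Vl[of x] \<open>0 \<le> T\<close> show ?thesis by simp
  next
    case False
    define W where "W = {x. N x = l *\<^sub>R x}"
    have W: "subspace W"
      by (auto simp: W_def subspace_def N.zero N.add N.scale scaleR_right_distrib mult.commute)
    have AW: "A *v x \<in> W" if "x \<in> W" for x
      using that by (simp add: W_def commN matrix_vector_mult_scaleR)
    have "u \<in> W" "u \<noteq> 0" using u by (auto simp: W_def)
    then have W0: "W \<noteq> {0}" by blast
    have linA2: "linear (\<lambda>x. - (A *v (A *v x)))"
      by (rule linearI) (simp_all add: matrix_vector_right_distrib matrix_vector_mult_scaleR)
    have A2W: "- (A *v (A *v x)) \<in> W" if "x \<in> W" for x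
      using that AW W by (intro subspace_neg) blast+
    have symA2: "x \<bullet> - (A *v (A *v y)) = - (A *v (A *v x)) \<bullet> y" for x y
      by (simp add: inner_skew[OF skew])
    \<comment> \<open>For an eigenvector \<open>w\<close> of \<open>- A\<^sup>2\<close> in
      \<open>W\<close>, the span of \<open>w\<close> and \<open>A *v w\<close> is invariant under
      \<open>A\<close> and stays inside \<open>W\<close>.\<close>
    obtain w q where w: "w \<in> W" "norm w = 1" "- (A *v (A *v w)) = q *\<^sub>R w"
      using selfadjoint_max_eigenvector[OF linA2 W W0 A2W symA2] .
    define \<theta> where "\<theta> = norm (A *v w)"
    \<comment> \<open>Otherwise \<open>w\<close> lies in the kernel of \<open>A\<close>, hence of
      \<open>V\<close>, and the top eigenvalue \<open>l\<close> would be zero.\<close>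
    have "\<theta> \<noteq> 0"
    proof
      assume "\<theta> = 0"
      then have "V *v w = 0" by (simp add: \<theta>_def ker)
      then have "N w = 0" by (simp add: N_def)
      with w False show False by (auto simp: W_def)
    qed
    have "q = w \<bullet> - (A *v (A *v w))" unfolding w(3) using w(2) by (simp add: norm_eq_1)
    also have "\<dots> = \<theta>\<^sup>2" by (simp add: inner_skew[OF skew, of w] \<theta>_def power2_norm_eq_inner)
    finally have q: "A *v (A *v w) = - (\<theta>\<^sup>2 *\<^sub>R w)" using w(3) by (metis minus_minus)
    define w' where "w' = (1 / \<theta>) *\<^sub>R (A *v w)"
    have w': "w' \<in> W" "w' \<bullet> w' = 1" "w \<bullet> w = 1" "w \<bullet> w' = 0"
    proof -
      show "w' \<in> W" unfolding w'_def using W AW w(1) by (intro subspace_scale)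
      show "w' \<bullet> w' = 1" using \<open>\<theta> \<noteq> 0\<close>
        by (simp add: w'_def \<theta>_def power2_norm_eq_inner[symmetric] power2_eq_square)
      show "w \<bullet> w = 1" using w(2) by (simp add: norm_eq_1)
      show "w \<bullet> w' = 0"
        using inner_skew[OF skew, of w w] by (simp add: w'_def inner_commute)
    qed
    have Aw: "A *v w = \<theta> *\<^sub>R w'" "A *v w' = - (\<theta> *\<^sub>R w)"
      using \<open>\<theta> \<noteq> 0\<close> by (simp_all add: w'_def matrix_vector_mult_scaleR q power2_eq_square)
    \<comment> \<open>The flow rotates the plane spanned by \<open>w\<close> and \<open>w'\<close>, so the component of the orbit there has constant length.\<close>
    let ?f = "\<lambda>t. mat_exp (t *\<^sub>R A) *v b"
    let ?h = "\<lambda>t. (w \<bullet> ?f t) * (w \<bullet> ?f t) + (w' \<bullet> ?f t) * (w' \<bullet> ?f t)"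
    have "(?h has_real_derivative 0) (at t)" for t
      by (rule DERIV_cong[OF DERIV_add[OF flow_inner_has_derivative flow_inner_has_derivative]])
        (simp add: inner_skew[OF skew] Aw)
    then have h: "?h t = (w \<bullet> b)\<^sup>2 + (w' \<bullet> b)\<^sup>2" for t
      using DERIV_isconst_all[of ?h t 0] by (simp add: mat_exp_0 power2_eq_square)
    have "(?h has_integral w \<bullet> (gramian T A b *v w) + w' \<bullet> (gramian T A b *v w')) {0..T}"
      by (intro has_integral_add gramian_has_integral)
    moreover have "(?h has_integral T * ((w \<bullet> b)\<^sup>2 + (w' \<bullet> b)\<^sup>2)) {0..T}"
      unfolding h using has_integral_const_real[of "(w \<bullet> b)\<^sup>2 + (w' \<bullet> b)\<^sup>2" 0 T] \<open>0 \<le> T\<close> by simp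
    ultimately have "w \<bullet> (gramian T A b *v w) + w' \<bullet> (gramian T A b *v w') = T * ((w \<bullet> b)\<^sup>2 + (w' \<bullet> b)\<^sup>2)"
      by (rule has_integral_unique)
    \<comment> \<open>Two unit vectors contribute \<open>c\<close> each; this is where the factor 2
      arises.\<close>
    with c[of w] c[of w'] w'(2,3) have plane: "2 * c \<le> T * ((w \<bullet> b)\<^sup>2 + (w' \<bullet> b)\<^sup>2)"
      by (simp add: power2_norm_eq_inner)
    \<comment> \<open>The orthogonal projection of \<open>b\<close> to the plane.\<close>
    define p where "p = (w \<bullet> b) *\<^sub>R w + (w' \<bullet> b) *\<^sub>R w'"
    have "p \<in> W" unfolding p_def using W w(1) w'(1) by (intro subspace_add subspace_scale)
    then have Np: "N p = l *\<^sub>R p" by (simp add: W_def)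
    have pp: "p \<bullet> p = (w \<bullet> b)\<^sup>2 + (w' \<bullet> b)\<^sup>2" and pb: "b \<bullet> p = (w \<bullet> b)\<^sup>2 + (w' \<bullet> b)\<^sup>2"
      using w' by (simp_all add: p_def inner_add inner_commute power2_eq_square)
    have "(norm (V *v b))\<^sup>2 = b \<bullet> N b" by (simp add: innerN power2_norm_eq_inner)
    also have "\<dots> = p \<bullet> N p + 2 * ((b - p) \<bullet> N p) + (b - p) \<bullet> N (b - p)"
      using symN[of b p] by (simp add: N.diff inner_diff inner_commute algebra_simps)
    \<comment> \<open>The cross term vanishes because \<open>N p\<close> is a multiple of
      \<open>p\<close> and \<open>b - p\<close> is orthogonal to \<open>p\<close>.\<close>
    also have "\<dots> = l * ((w \<bullet> b)\<^sup>2 + (w' \<bullet> b)\<^sup>2) + (norm (V *v (b - p)))\<^sup>2"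
      unfolding innerN[of "b - p" "b - p"] by (simp add: Np pp pb inner_diff_left power2_norm_eq_inner)
    finally have Vb: "l * ((w \<bullet> b)\<^sup>2 + (w' \<bullet> b)\<^sup>2) \<le> (norm (V *v b))\<^sup>2" by simp
    have "2 * c * (norm (V *v x))\<^sup>2 \<le> 2 * c * (l * (norm x)\<^sup>2)"
      using Vl \<open>0 \<le> c\<close> by (intro mult_left_mono) auto
    also have "\<dots> \<le> T * ((w \<bullet> b)\<^sup>2 + (w' \<bullet> b)\<^sup>2) * (l * (norm x)\<^sup>2)"
      using plane \<open>0 \<le> l\<close> by (intro mult_right_mono) auto
    also have "\<dots> = T * (l * ((w \<bullet> b)\<^sup>2 + (w' \<bullet> b)\<^sup>2)) * (norm x)\<^sup>2" by simp
    also have "\<dots> \<le> T * (norm (V *v b))\<^sup>2 * (norm x)\<^sup>2"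
      using Vb \<open>0 \<le> T\<close> by (intro mult_right_mono mult_left_mono) auto
    finally show ?thesis .
  qed
qed

subsection \<open>Distance of the flow from a reflection\<close>

text \<open>Necessity of \<open>\<sigma> = 1\<close> is stated for \<open>CARD('n) \<ge> 2\<close>:
  in dimension one \<open>A = 0\<close> and \<open>P0 = mat 1\<close>, so both signs give the same
  matrix. The existence clause still provides \<open>\<sigma> = 1\<close> in that case.\<close>

theorem theorem4p1:
  fixes A P0 :: "real^'n^'n" and b :: "real^'n" and T \<epsilon> :: real
  assumes "transpose A = - A"
    and "T > 0"
    and "norm b = 1"
    and "0 \<le> \<epsilon>" and "\<epsilon> < 1"
    and "lambda_min (gramian T A b) \<ge> (1 - \<epsilon>) * (T / real CARD('n))"
    and "orthogonal_projector_onto P0 (mat_kernel A)"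
  defines "R \<equiv> sqrt (real CARD('n) / (1 - \<epsilon>)) * op_norm A * T * \<epsilon>"
  shows "controllable A b
    \<and> (\<exists>\<sigma>\<in>{-1, 1}.
          op_norm (mat_exp (T *\<^sub>R A) - (P0 + \<sigma> *\<^sub>R (mat 1 - P0))) \<le> R
        \<and> (dim (mat_kernel A) = 1 \<and> R < sqrt 2 \<longrightarrow> \<sigma> = 1))
    \<and> (CARD('n) \<ge> 2 \<and> dim (mat_kernel A) = 1 \<and> R < sqrt 2 \<longrightarrow>
         (\<forall>\<sigma>\<in>{-1, 1}.
            op_norm (mat_exp (T *\<^sub>R A) - (P0 + \<sigma> *\<^sub>R (mat 1 - P0))) \<le> R \<longrightarrow> \<sigma> = 1))"
proof -
  note skew = assms(1)
  define c where "c = (1 - \<epsilon>) * (T / real CARD('n))"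
  have "c > 0" using assms(2,5) by (simp add: c_def)
  have c: "c * (norm x)\<^sup>2 \<le> x \<bullet> (gramian T A b *v x)" for x
    using mult_right_mono[OF assms(6), of "(norm x)\<^sup>2"] lambda_min_le_rayleigh[OF gramian_transpose, of T A b x]
    by (simp add: c_def)
  have controllable: "controllable A b"
  proof (rule controllable_if_gramian_pos)
    show "0 < x \<bullet> (gramian T A b *v x)" if "x \<noteq> 0" for x
      using c[of x] \<open>c > 0\<close> that by (intro less_le_trans[OF _ c]) simp
  qed
  have "P0 ** P0 = P0" "transpose P0 = P0" and range: "range (\<lambda>x. P0 *v x) = mat_kernel A"
    using assms(7) by (auto simp: orthogonal_projector_onto_def)
  then have P0P0: "P0 *v (P0 *v x) = P0 *v x" and P0sym: "x \<bullet> (P0 *v y) = (P0 *v x) \<bullet> y" for x y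
    by (simp_all add: matrix_vector_mul_assoc inner_matrix_vector del: transpose_matrix_vector)
  have AP0: "A *v (P0 *v x) = 0" for x
    using range by (auto simp: mat_kernel_def)
  have P0ker: "P0 *v x = x" if "A *v x = 0" for x
  proof -
    have "x \<in> range (\<lambda>x. P0 *v x)" using that range by (simp add: mat_kernel_def)
    then show ?thesis using P0P0 by auto
  qed
  \<comment> \<open>The range of a skew matrix is orthogonal to its kernel.\<close>
  have P0A: "P0 *v (A *v x) = 0" for x
  proof -
    have "(P0 *v (A *v x)) \<bullet> (P0 *v (A *v x)) = (P0 *v (P0 *v (A *v x))) \<bullet> (A *v x)"
      by (rule P0sym)
    then show ?thesis by (simp add: inner_skew[OF skew] AP0)
  qed
  define U where "U = mat_exp (T *\<^sub>R A)"
  define V where "V \<sigma> = U - (P0 + \<sigma> *\<^sub>R (mat 1 - P0))" for \<sigma>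
  have V: "V \<sigma> *v x = U *v x - P0 *v x - \<sigma> *\<^sub>R (x - P0 *v x)" for \<sigma> x
    by (simp add: V_def matrix_vector_mult_diff_rdistrib matrix_vector_mult_add_rdistrib
        scaleR_matrix_vector_assoc[symmetric] algebra_simps)
  have P0U: "P0 *v (U *v x) = P0 *v x" for x
  proof -
    have "y \<bullet> (P0 *v (U *v x)) = y \<bullet> (P0 *v x)" for y
      by (simp add: P0sym U_def inner_flow_kernel[OF skew] AP0)
    then show ?thesis using vector_eq_ldot by blast
  qed
  have comm: "V \<sigma> *v (A *v x) = A *v (V \<sigma> *v x)" for \<sigma> x
  proof -
    have "U *v (A *v x) = A *v (U *v x)"
      by (simp add: U_def matrix_vector_mul_assoc mat_exp_commute)
    then show ?thesis
      by (simp add: V P0A AP0 matrix_vector_mult_diff_distrib matrix_vector_mult_scaleR)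
  qed
  have ker: "V \<sigma> *v x = 0" if "A *v x = 0" for \<sigma> x
    using that by (simp add: V P0ker U_def flow_kernel[OF skew])
  define r where "r = op_norm A * T * \<epsilon>"
  have "0 \<le> r" unfolding r_def op_norm_def using assms(2,4)
    by (intro mult_nonneg_nonneg onorm_pos_le matrix_vector_mul_bounded_linear) auto
  \<comment> \<open>Here \<open>T / c\<close> equals
    \<open>real CARD('n) / (1 - \<epsilon>)\<close>.\<close>
  have R: "R = sqrt (T / c) * r"
    using assms(2,5) by (simp add: R_def r_def c_def field_simps)
  have "0 \<le> R" unfolding R using \<open>0 \<le> r\<close> \<open>c > 0\<close> assms(2) by simp
  have R2: "R\<^sup>2 = T / c * r\<^sup>2"
    unfolding R using \<open>c > 0\<close> assms(2) by (simp add: power_mult_distrib)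
  define d s where "d = U *v b - b" and "s = U *v b + b"
  have "T - real CARD('n) * c = T * \<epsilon>"
    by (simp add: c_def field_simps)
  moreover have "norm d * norm s \<le> 2 * op_norm A * (T * (norm b)\<^sup>2 - real CARD('n) * c)"
    unfolding d_def s_def U_def using assms(2) by (intro gramian_endpoint_bound[OF skew _ c]) simp
  ultimately have "norm d * norm s \<le> 2 * r"
    by (simp add: assms(3) r_def mult.assoc)
  then have "(norm d * norm s)\<^sup>2 \<le> (2 * r)\<^sup>2"
    by (rule power_mono) simp
  then have ds: "(norm d)\<^sup>2 * (norm s)\<^sup>2 \<le> 4 * r\<^sup>2"
    by (simp add: power_mult_distrib)
  have bb: "b \<bullet> b = 1" "(U *v b) \<bullet> (U *v b) = 1"
    using assms(3) by (simp_all add: U_def flow_inner[OF skew] norm_eq_1)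
  have d2: "(norm d)\<^sup>2 = 2 - 2 * (b \<bullet> (U *v b))" and s2: "(norm s)\<^sup>2 = 2 + 2 * (b \<bullet> (U *v b))"
    by (simp_all add: d_def s_def power2_norm_eq_inner inner_diff inner_add bb inner_commute)
  \<comment> \<open>The 2 in the hypothesis on \<open>V \<sigma> *v b\<close> cancels against the 2
    in \<open>commuting_norm_bound\<close>, leaving exactly \<open>R\<close>.\<close>
  have bound: "op_norm (V \<sigma>) \<le> R" if "(norm (V \<sigma> *v b))\<^sup>2 \<le> 2 * r\<^sup>2" for \<sigma>
    unfolding op_norm_def
  proof (rule onorm_le)
    fix x
    have "2 * c * (norm (V \<sigma> *v x))\<^sup>2 \<le> T * (norm (V \<sigma> *v b))\<^sup>2 * (norm x)\<^sup>2"
      using assms(2) \<open>c > 0\<close> by (intro commuting_norm_bound[OF skew _ _ c] comm ker) auto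
    also have "\<dots> \<le> T * (2 * r\<^sup>2) * (norm x)\<^sup>2"
      using that assms(2) by (intro mult_right_mono mult_left_mono) auto
    finally have "(norm (V \<sigma> *v x))\<^sup>2 \<le> (R * norm x)\<^sup>2"
      using \<open>c > 0\<close> by (simp add: power_mult_distrib R2 field_simps)
    then show "norm (V \<sigma> *v x) \<le> R * norm x"
      by (rule power2_le_imp_le) (use \<open>0 \<le> R\<close> in simp)
  qed
  have ex: "\<exists>\<sigma>\<in>{-1, 1}. op_norm (V \<sigma>) \<le> R \<and> (dim (mat_kernel A) = 1 \<and> R < sqrt 2 \<longrightarrow> \<sigma> = 1)"
  \<comment> \<open>The sign decides which of \<open>s\<close> and \<open>d\<close> has squared
    length at least 2; the other one is then short.\<close>
  proof (cases "0 \<le> b \<bullet> (U *v b)")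
    case True
    have "(norm d)\<^sup>2 * 2 \<le> (norm d)\<^sup>2 * (norm s)\<^sup>2"
      using True s2 by (intro mult_left_mono) auto
    moreover have "V 1 *v b = d" by (simp add: V d_def)
    ultimately have "op_norm (V 1) \<le> R" using ds by (intro bound) simp
    then show ?thesis by auto
  next
    case False
    have "2 * (norm s)\<^sup>2 \<le> (norm d)\<^sup>2 * (norm s)\<^sup>2"
      using False d2 by (intro mult_right_mono) auto
    then have s_le: "2 * (norm s)\<^sup>2 \<le> 4 * r\<^sup>2" using ds by linarith
    \<comment> \<open>Both \<open>U *v b\<close> and \<open>b\<close> have the same projection to
      the kernel, so \<open>P0 *v s\<close> is twice \<open>P0 *v b\<close>.\<close>
    have "V (-1) *v b = s - P0 *v s"
      by (simp add: V s_def matrix_vector_right_distrib P0U)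
    moreover have "(norm (s - P0 *v s))\<^sup>2 + (norm (P0 *v s))\<^sup>2 = (norm s)\<^sup>2"
      using P0sym[of s "P0 *v s"]
      by (simp add: P0P0 power2_norm_eq_inner inner_diff inner_commute)
    ultimately have "(norm (V (-1) *v b))\<^sup>2 \<le> 2 * r\<^sup>2"
      using s_le zero_le_power2[of "norm (P0 *v s)"] by (simp only:)
    then have "op_norm (V (-1)) \<le> R" by (rule bound)
    \<comment> \<open>With \<open>\<sigma> = -1\<close> chosen, the implication about
      \<open>\<sigma> = 1\<close> can hold only because its premise fails.\<close>
    moreover have "sqrt 2 \<le> R" if "dim (mat_kernel A) = 1"
    proof -
      have "\<not> mat_kernel A \<subseteq> {0}" using that dim_eq_0[of "mat_kernel A"] by simp
      then obtain x where x: "A *v x = 0" "x \<noteq> 0" by (auto simp: mat_kernel_def)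
      have c_le: "c * (norm x)\<^sup>2 \<le> T * (x \<bullet> b)\<^sup>2"
        using kernel_component_bound[OF skew _ x(1) c] assms(2) by simp
      have "2 * \<bar>x \<bullet> b\<bar> = \<bar>x \<bullet> s\<bar>"
        using inner_flow_kernel[OF skew x(1), of T b] by (simp add: s_def U_def inner_add)
      then have "2 * \<bar>x \<bullet> b\<bar> \<le> norm x * norm s"
        using Cauchy_Schwarz_ineq2[of x s] by simp
      then have "(2 * \<bar>x \<bullet> b\<bar>)\<^sup>2 \<le> (norm x * norm s)\<^sup>2"
        by (rule power_mono) simp
      then have "4 * (x \<bullet> b)\<^sup>2 \<le> (norm x)\<^sup>2 * (norm s)\<^sup>2"
        by (simp add: power_mult_distrib)
      also have "\<dots> \<le> (norm x)\<^sup>2 * (2 * r\<^sup>2)"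
        using s_le by (intro mult_left_mono) auto
      finally have "T * (4 * (x \<bullet> b)\<^sup>2) \<le> T * ((norm x)\<^sup>2 * (2 * r\<^sup>2))"
        using assms(2) by (intro mult_left_mono) auto
      with c_le have "(norm x)\<^sup>2 * (4 * c) \<le> (norm x)\<^sup>2 * (T * (2 * r\<^sup>2))"
        by (simp add: algebra_simps)
      then have "4 * c \<le> T * (2 * r\<^sup>2)" using x(2) by simp
      then have "2 \<le> R\<^sup>2" using \<open>c > 0\<close> by (simp add: R2 field_simps)
      then show ?thesis using \<open>0 \<le> R\<close> by (intro real_le_lsqrt)
    qed
    ultimately show ?thesis by (intro bexI[of _ "-1"]) auto
  qed
  \<comment> \<open>If both signs met the bound, the parallelogram law for \<open>U *v x\<close> and
    \<open>x\<close>, with \<open>x\<close> nonzero and orthogonal to the kernel, would give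
    \<open>4 \<le> 2 * R\<^sup>2\<close>. Such an \<open>x\<close> exists because the kernel is a
    line in dimension at least two.\<close>
  have uniq: "\<sigma> = 1"
    if "CARD('n) \<ge> 2" "dim (mat_kernel A) = 1" "R < sqrt 2" "\<sigma> \<in> {-1, 1}" "op_norm (V \<sigma>) \<le> R" for \<sigma>
  proof (rule ccontr)
    assume "\<sigma> \<noteq> 1"
    with that have minus: "op_norm (V (-1)) \<le> R" by auto
    have plus: "op_norm (V 1) \<le> R" using ex that by auto
    have "mat_kernel A \<noteq> UNIV"
      using that(1,2) by auto
    then obtain y where y: "A *v y \<noteq> 0" by (auto simp: mat_kernel_def)
    define x where "x = y - P0 *v y"
    have "x \<noteq> 0" using y AP0[of y] by (auto simp: x_def)
    have "P0 *v x = 0" by (simp add: x_def matrix_vector_mult_diff_distrib P0P0)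
    then have Vx: "V 1 *v x = U *v x - x" "V (-1) *v x = U *v x + x" by (simp_all add: V)
    have "(norm (V \<tau> *v x))\<^sup>2 \<le> R\<^sup>2 * (norm x)\<^sup>2" if "op_norm (V \<tau>) \<le> R" for \<tau>
      unfolding power_mult_distrib[symmetric]
      by (rule power_mono[OF order_trans[OF op_norm_bound mult_right_mono[OF that]]]) simp_all
    from this[OF plus] this[OF minus]
    have "(norm (U *v x - x))\<^sup>2 + (norm (U *v x + x))\<^sup>2 \<le> 2 * R\<^sup>2 * (norm x)\<^sup>2"
      by (simp add: Vx)
    moreover have "(norm (U *v x - x))\<^sup>2 + (norm (U *v x + x))\<^sup>2 = 4 * (norm x)\<^sup>2"
      using flow_inner[OF skew, of T x x]
      by (simp add: U_def power2_norm_eq_inner inner_diff inner_add inner_commute)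
    ultimately have "2 \<le> R\<^sup>2" using \<open>x \<noteq> 0\<close> by simp
    moreover have "R\<^sup>2 < 2"
      using power_strict_mono[OF that(3) \<open>0 \<le> R\<close>, of 2] by simp
    ultimately show False by simp
  qed
  show ?thesis
    unfolding U_def[symmetric] V_def[symmetric]
  proof (intro conjI impI ballI)
    show "controllable A b" by fact
    show "\<exists>\<sigma>\<in>{-1, 1}. op_norm (V \<sigma>) \<le> R \<and> (dim (mat_kernel A) = 1 \<and> R < sqrt 2 \<longrightarrow> \<sigma> = 1)" by fact
  qed (use uniq in auto)
qed

end
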